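(* Let $p\ge1$, $\tau^*\ge1$, $\delta\in\mathbb R^p$ with $\lVert\delta\rVert>0$, and let $y_t=\varepsilon_t$ for $t\le\tau^*$ and $y_t=\delta+\varepsilon_t$ for $t>\tau^*$, with $\varepsilon_t$ i.i.d. $\mathcal N_p(0,I_p)$. Let $c>0$ be a fixed threshold and let $T$ be the first time $n$ at which $\max_{1\le\tau<n}S^{\#p}_{\tau,n}(0)\ge c$, where $$S^{\#p}_{\tau,n}(0)=\Big\lVert\frac{1}{\sqrt{n-\tau}}\sum_{t=\tau+1}^n y_t\Big\rVert^2$$ is the dense statistic with known pre-change mean $0$. Then the average detection delay $$\mathrm{ADD}=\sup_{y_1,\dots,y_{\tau^*}}\mathbb E\big(T-\tau^*\mid T\ge\tau^*\big)$$ satisfies $$\mathrm{ADD}\le\frac{c+\lVert\delta\rVert\sqrt{8/\pi}}{\lVert\delta\rVert^2}+1.$$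
   Context: $\lVert\cdot\rVert$ is the Euclidean norm. The supremum is over values of the pre-change data $y_1,\dots,y_{\tau^*}$ compatible with $T\ge\tau^*$, the expectation being conditional on these values (worst-case expected time from the change until it is detected, given no detection before $\tau^*$). *)

theory Defs
  imports "HOL-Probability.Probability"
begin

definition std_mvn_density :: "real ^ 'p \<Rightarrow> real" where
  "std_mvn_density x = exp (- (norm x)\<^sup>2 / 2) / sqrt (2 * pi) ^ CARD('p)"

definition dense_stat :: "(nat \<Rightarrow> 'v::real_normed_vector) \<Rightarrow> nat \<Rightarrow> nat \<Rightarrow> real" where
  "dense_stat y \<tau> n =
     (norm ((1 / sqrt (real n - real \<tau>)) *\<^sub>R (\<Sum>t = \<tau> + 1..n. y t)))\<^sup>2"

text \<open>
  Observations are indexed from 1; the value at index 0 is never used. The maximum is over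
  a nonempty set exactly when \<open>n \<ge> 2\<close>. If the threshold is never reached, the infimum of
  the empty set gives \<open>\<infinity>\<close>.
\<close>

definition detection_time :: "real \<Rightarrow> (nat \<Rightarrow> 'v::real_normed_vector) \<Rightarrow> enat" where
  "detection_time c y =
     Inf (enat ` {n. 2 \<le> n \<and> c \<le> (MAX \<tau>\<in>{1..<n}. dense_stat y \<tau> n)})"

definition with_past :: "nat \<Rightarrow> (nat \<Rightarrow> 'v) \<Rightarrow> (nat \<Rightarrow> 'v) \<Rightarrow> nat \<Rightarrow> 'v" where
  "with_past k x z = (\<lambda>t. if t \<le> k then x t else z t)"

text \<open>
  The conditional expectation of the delay given \<open>y\<^sub>1 = x\<^sub>1, \<dots>, y\<^sub>k = x\<^sub>k\<close>. As the observations
  are independent, conditioning on these values amounts to fixing them and averaging over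
  the later observations. The result is defined for every value of the data, not only almost
  everywhere, so that its supremum makes sense; the lemma
  \<open>nn_cond_exp_delay\<close> below shows that it is a version of the conditional expectation.
\<close>

definition cond_delay ::
    "'a measure \<Rightarrow> (nat \<Rightarrow> 'a \<Rightarrow> 'v::real_normed_vector) \<Rightarrow> nat \<Rightarrow> real \<Rightarrow> (nat \<Rightarrow> 'v) \<Rightarrow> ennreal" where
  "cond_delay M y k c x =
     (\<integral>\<^sup>+ \<omega>. ennreal_of_enat (detection_time c (with_past k x (\<lambda>t. y t \<omega>)) - enat k) \<partial>M)"

text \<open>
  The supremum is taken over whole sequences \<open>x\<close>, but only \<open>x\<^sub>1, \<dots>, x\<^sub>k\<close> matter, both for the
  condition (\<open>detection_time_ge_with_past\<close>) and for the conditional expectation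
  (\<open>cond_delay_cong\<close>). In particular the event that the detection time is at least \<open>k\<close> is
  decided by these values, so conditioning on it restricts the range of the supremum and
  has no further effect.
\<close>

definition ADD ::
    "'a measure \<Rightarrow> (nat \<Rightarrow> 'a \<Rightarrow> 'v::real_normed_vector) \<Rightarrow> nat \<Rightarrow> real \<Rightarrow> ennreal" where
  "ADD M y k c = (SUP x \<in> {x. enat k \<le> detection_time c x}. cond_delay M y k c x)"

lemma dense_stat_cong:
  assumes "\<And>t. \<tau> < t \<Longrightarrow> t \<le> n \<Longrightarrow> x t = y t"
  shows "dense_stat x \<tau> n = dense_stat y \<tau> n"
proof -
  have "(\<Sum>t = \<tau> + 1..n. x t) = (\<Sum>t = \<tau> + 1..n. y t)"
    by (rule sum.cong) (use assms in auto)
  then show ?thesis by (simp add: dense_stat_def)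
qed

lemma Max_dense_stat_cong:
  assumes "\<And>t. 1 \<le> t \<Longrightarrow> t \<le> n \<Longrightarrow> x t = y t"
  shows "(MAX \<tau>\<in>{1..<n}. dense_stat x \<tau> n) = (MAX \<tau>\<in>{1..<n}. dense_stat y \<tau> n)"
proof -
  have "(\<lambda>\<tau>. dense_stat x \<tau> n) ` {1..<n} = (\<lambda>\<tau>. dense_stat y \<tau> n) ` {1..<n}"
    by (intro image_cong refl dense_stat_cong) (use assms in auto)
  then show ?thesis by simp
qed

lemma detection_time_cong:
  assumes "\<And>t. 1 \<le> t \<Longrightarrow> x t = y t"
  shows "detection_time c x = detection_time c y"
proof -
  have "(MAX \<tau>\<in>{1..<n}. dense_stat x \<tau> n) = (MAX \<tau>\<in>{1..<n}. dense_stat y \<tau> n)" for n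
    by (rule Max_dense_stat_cong) (use assms in auto)
  then show ?thesis by (simp add: detection_time_def)
qed

lemma enat_le_detection_time_iff:
  "enat k \<le> detection_time c x \<longleftrightarrow>
     (\<forall>n. 2 \<le> n \<longrightarrow> n < k \<longrightarrow> (MAX \<tau>\<in>{1..<n}. dense_stat x \<tau> n) < c)"
proof -
  have *: "enat k \<le> Inf (enat ` {n. 2 \<le> n \<and> c \<le> X n}) \<longleftrightarrow>
      (\<forall>n. 2 \<le> n \<longrightarrow> n < k \<longrightarrow> X n < c)" for X :: "nat \<Rightarrow> real"
    by (auto simp: le_Inf_iff not_le[symmetric] simp del: not_le)
  show ?thesis
    unfolding detection_time_def by (rule *)
qed

lemma detection_time_ge_with_past:
  "enat k \<le> detection_time c (with_past k x z) \<longleftrightarrow> enat k \<le> detection_time c x"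
proof -
  have "(MAX \<tau>\<in>{1..<n}. dense_stat (with_past k x z) \<tau> n) = (MAX \<tau>\<in>{1..<n}. dense_stat x \<tau> n)"
    if "n < k" for n
    by (rule Max_dense_stat_cong) (use that in \<open>auto simp: with_past_def\<close>)
  then show ?thesis by (auto simp: enat_le_detection_time_iff)
qed

lemma cond_delay_cong:
  assumes "\<And>t. 1 \<le> t \<Longrightarrow> t \<le> k \<Longrightarrow> x t = x' t"
  shows "cond_delay M y k c x = cond_delay M y k c x'"
proof -
  have "detection_time c (with_past k x z) = detection_time c (with_past k x' z)" for z
    by (rule detection_time_cong) (use assms in \<open>auto simp: with_past_def\<close>)
  then show ?thesis by (simp add: cond_delay_def)
qed

lemma measurable_detection_time:
  fixes Y :: "nat \<Rightarrow> 'a \<Rightarrow> 'v::euclidean_space"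
  assumes Y: "\<And>t. 1 \<le> t \<Longrightarrow> Y t \<in> borel_measurable N"
  shows "(\<lambda>\<omega>. detection_time c (\<lambda>t. Y t \<omega>)) \<in> N \<rightarrow>\<^sub>M count_space UNIV"
proof -
  have [measurable]: "(\<lambda>\<omega>. dense_stat (\<lambda>t. Y t \<omega>) \<tau> n) \<in> borel_measurable N" for \<tau> n
    unfolding dense_stat_def using Y by measurable
  have M [measurable]: "(\<lambda>\<omega>. MAX \<tau>\<in>{1..<n}. dense_stat (\<lambda>t. Y t \<omega>) \<tau> n) \<in> borel_measurable N" for n
    by (rule borel_measurable_Max) auto
  define P where "P n \<omega> \<longleftrightarrow> 2 \<le> n \<and> c \<le> (MAX \<tau>\<in>{1..<n}. dense_stat (\<lambda>t. Y t \<omega>) \<tau> n)" for n \<omega>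
  have [measurable]: "Measurable.pred N (P n)" for n
    unfolding P_def by measurable
  have dt: "detection_time c (\<lambda>t. Y t \<omega>) = Inf (enat ` {n. P n \<omega>})" for \<omega>
    unfolding detection_time_def P_def by (rule refl)
  have eq: "detection_time c (\<lambda>t. Y t \<omega>) = (if \<exists>n. P n \<omega> then enat (LEAST n. P n \<omega>) else \<infinity>)" for \<omega>
  proof (cases "\<exists>n. P n \<omega>")
    case True
    have "Inf (enat ` {n. P n \<omega>}) = enat (LEAST n. P n \<omega>)"
    proof (rule antisym)
      show "Inf (enat ` {n. P n \<omega>}) \<le> enat (LEAST n. P n \<omega>)"
        by (rule Inf_lower) (use LeastI_ex[OF True] in blast)
      show "enat (LEAST n. P n \<omega>) \<le> Inf (enat ` {n. P n \<omega>})"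
        by (rule Inf_greatest) (auto intro: Least_le)
    qed
    with True show ?thesis by (simp add: dt)
  next
    case False
    then have "Inf (enat ` {n. P n \<omega>}) = \<infinity>"
      by (simp add: top_enat_def)
    with False show ?thesis by (simp only: dt if_False)
  qed
  show ?thesis unfolding eq by measurable
qed

lemma (in prob_space) nn_cond_exp_delay:
  fixes y :: "nat \<Rightarrow> 'a \<Rightarrow> 'v::euclidean_space" and k :: nat
  assumes ind: "indep_vars (\<lambda>_. borel) y {1..}"
  defines "F \<equiv> vimage_algebra (space M) (\<lambda>\<omega>. restrict (\<lambda>t. y t \<omega>) {1..k}) (PiM {1..k} (\<lambda>_. borel))"
  shows "AE \<omega> in M. cond_delay M y k c (\<lambda>t. y t \<omega>) =
           nn_cond_exp M F (\<lambda>\<omega>. ennreal_of_enat (detection_time c (\<lambda>t. y t \<omega>) - enat k)) \<omega>"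
proof -
  define PA where "PA = (PiM {1..k} (\<lambda>_. borel) :: (nat \<Rightarrow> 'v) measure)"
  define PB where "PB = (PiM {k+1..} (\<lambda>_. borel) :: (nat \<Rightarrow> 'v) measure)"
  define A where "A = (\<lambda>\<omega>. restrict (\<lambda>t. y t \<omega>) {1..k})"
  define B where "B = (\<lambda>\<omega>. restrict (\<lambda>t. y t \<omega>) {k+1..})"
  define G where "G = (\<lambda>(a, b). ennreal_of_enat (detection_time c (with_past k a b :: nat \<Rightarrow> 'v) - enat k))"
  have "indep_var (PiM {1..k} (\<lambda>_. borel)) A (PiM {k+1..} (\<lambda>_. borel)) B"
    unfolding A_def B_def by (rule indep_var_restrict[OF ind]) auto
  then have iv: "indep_var PA A PB B" by (simp add: PA_def PB_def)
  then have A [measurable]: "A \<in> M \<rightarrow>\<^sub>M PA" and B [measurable]: "B \<in> M \<rightarrow>\<^sub>M PB"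
    and D: "distr M PA A \<Otimes>\<^sub>M distr M PB B = distr M (PA \<Otimes>\<^sub>M PB) (\<lambda>x. (A x, B x))"
    by (auto simp: indep_var_distribution_eq)
  have G [measurable]: "G \<in> borel_measurable (PA \<Otimes>\<^sub>M PB)"
  proof -
    have "(\<lambda>p. with_past k (fst p) (snd p) t) \<in> borel_measurable (PA \<Otimes>\<^sub>M PB)" if "1 \<le> t" for t
    proof (cases "t \<le> k")
      case True
      with that have "t \<in> {1..k}" by simp
      then have [measurable]: "(\<lambda>a. a t) \<in> borel_measurable PA"
        unfolding PA_def by (rule measurable_component_singleton)
      show ?thesis using True by (simp add: with_past_def)
    next
      case False
      then have "t \<in> {k+1..}" by simp
      then have [measurable]: "(\<lambda>a. a t) \<in> borel_measurable PB"
        unfolding PB_def by (rule measurable_component_singleton)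
      show ?thesis using False by (simp add: with_past_def)
    qed
    from measurable_detection_time[of "\<lambda>t p. with_past k (fst p) (snd p) t", OF this]
    have "(\<lambda>p. detection_time c (with_past k (fst p) (snd p))) \<in> PA \<Otimes>\<^sub>M PB \<rightarrow>\<^sub>M count_space UNIV"
      by simp
    then have "(\<lambda>p. ennreal_of_enat (detection_time c (with_past k (fst p) (snd p)) - enat k))
        \<in> borel_measurable (PA \<Otimes>\<^sub>M PB)"
      by (rule measurable_compose) simp
    then show ?thesis by (simp add: G_def case_prod_beta')
  qed
  have f_eq: "ennreal_of_enat (detection_time c (\<lambda>t. y t \<omega>) - enat k) = G (A \<omega>, B \<omega>)" for \<omega>
  proof -
    have "detection_time c (\<lambda>t. y t \<omega>) = detection_time c (with_past k (A \<omega>) (B \<omega>))"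
      by (rule detection_time_cong) (auto simp: with_past_def A_def B_def)
    then show ?thesis by (simp add: G_def)
  qed
  have g_eq: "cond_delay M y k c (\<lambda>t. y t \<omega>) = (\<integral>\<^sup>+ b. G (A \<omega>, b) \<partial>distr M PB B)"
    if "\<omega> \<in> space M" for \<omega>
  proof -
    have "A \<omega> \<in> space PA" using that A by (rule measurable_space[rotated])
    have "detection_time c (with_past k (\<lambda>t. y t \<omega>) (\<lambda>t. y t \<omega>')) = detection_time c (with_past k (A \<omega>) (B \<omega>'))" for \<omega>'
      by (rule detection_time_cong) (auto simp: with_past_def A_def B_def)
    then have "cond_delay M y k c (\<lambda>t. y t \<omega>) = (\<integral>\<^sup>+ \<omega>'. G (A \<omega>, B \<omega>') \<partial>M)"
      by (simp add: G_def cond_delay_def)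
    also have "\<dots> = (\<integral>\<^sup>+ b. G (A \<omega>, b) \<partial>distr M PB B)"
      by (subst nn_integral_distr) (use \<open>A \<omega> \<in> space PA\<close> in auto)
    finally show ?thesis .
  qed
  interpret B: prob_space "distr M PB B" by (rule prob_space_distr) simp
  have AF [measurable]: "A \<in> F \<rightarrow>\<^sub>M PA"
    unfolding F_def A_def PA_def by (rule measurable_vimage_algebra1) (auto simp: space_PiM)
  have setsF: "sets F = {A -` X \<inter> space M | X. X \<in> sets PA}"
    unfolding F_def A_def PA_def by (rule sets_vimage_algebra2) (auto simp: space_PiM)
  have sub: "subalgebra M F"
    unfolding subalgebra_def setsF using measurable_sets[OF A] by (auto simp: F_def)
  interpret S: finite_measure_subalgebra M F
    by standard (fact sub)
  have H [measurable]: "(\<lambda>a. \<integral>\<^sup>+ b. G (a, b) \<partial>distr M PB B) \<in> borel_measurable PA"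
    by (rule B.borel_measurable_nn_integral) (simp add: measurable_cong_sets[OF sets_pair_measure_cong[OF refl sets_distr] refl])
  have "AE \<omega> in M. (\<integral>\<^sup>+ b. G (A \<omega>, b) \<partial>distr M PB B) = nn_cond_exp M F (\<lambda>\<omega>. G (A \<omega>, B \<omega>)) \<omega>"
  proof (rule S.nn_cond_exp_charact)
    show "(\<lambda>\<omega>. G (A \<omega>, B \<omega>)) \<in> borel_measurable M" by measurable
    show "(\<lambda>\<omega>. \<integral>\<^sup>+ b. G (A \<omega>, b) \<partial>distr M PB B) \<in> borel_measurable F"
      by (rule measurable_compose[OF AF H])
    fix U assume "U \<in> sets F"
    then obtain X where X [measurable]: "X \<in> sets PA" and U: "U = A -` X \<inter> space M"
      by (auto simp: setsF)
    have ind_U: "indicator U \<omega> = (indicator X (A \<omega>) :: ennreal)" if "\<omega> \<in> space M" for \<omega>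
      using that by (auto simp: U indicator_def)
    have "(\<integral>\<^sup>+ \<omega>\<in>U. G (A \<omega>, B \<omega>) \<partial>M) = (\<integral>\<^sup>+ \<omega>. (\<lambda>p. G p * indicator X (fst p)) (A \<omega>, B \<omega>) \<partial>M)"
      by (rule nn_integral_cong) (simp add: ind_U)
    also have "\<dots> = (\<integral>\<^sup>+ p. G p * indicator X (fst p) \<partial>distr M (PA \<Otimes>\<^sub>M PB) (\<lambda>x. (A x, B x)))"
      by (rule nn_integral_distr[symmetric]) measurable
    also have "\<dots> = (\<integral>\<^sup>+ p. G p * indicator X (fst p) \<partial>(distr M PA A \<Otimes>\<^sub>M distr M PB B))"
      by (simp add: D)
    also have "\<dots> = (\<integral>\<^sup>+ a. \<integral>\<^sup>+ b. G (a, b) * indicator X a \<partial>distr M PB B \<partial>distr M PA A)"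
    proof -
      have "(\<lambda>p. G p * indicator X (fst p)) \<in> borel_measurable (PA \<Otimes>\<^sub>M PB)" by measurable
      then have "(\<lambda>p. G p * indicator X (fst p)) \<in> borel_measurable (distr M PA A \<Otimes>\<^sub>M distr M PB B)"
        by (simp add: D)
      from B.nn_integral_fst[OF this] show ?thesis by simp
    qed
    also have "\<dots> = (\<integral>\<^sup>+ a. (\<integral>\<^sup>+ b. G (a, b) \<partial>distr M PB B) * indicator X a \<partial>distr M PA A)"
      by (intro nn_integral_cong nn_integral_multc) auto
    also have "\<dots> = (\<integral>\<^sup>+ \<omega>. (\<integral>\<^sup>+ b. G (A \<omega>, b) \<partial>distr M PB B) * indicator X (A \<omega>) \<partial>M)"
      by (rule nn_integral_distr) measurable
    also have "\<dots> = (\<integral>\<^sup>+ \<omega>\<in>U. (\<integral>\<^sup>+ b. G (A \<omega>, b) \<partial>distr M PB B) \<partial>M)"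
      by (rule nn_integral_cong) (simp add: ind_U)
    finally show "(\<integral>\<^sup>+ \<omega>\<in>U. G (A \<omega>, B \<omega>) \<partial>M) = (\<integral>\<^sup>+ \<omega>\<in>U. (\<integral>\<^sup>+ b. G (A \<omega>, b) \<partial>distr M PB B) \<partial>M)" .
  qed
  then show ?thesis
    unfolding f_eq using AE_space by eventually_elim (simp add: g_eq)
qed

end

theory Submission
  imports Defs
begin

text \<open>
  Write \<open>d = norm \<delta>\<close>. Only the candidate change point \<open>\<tau>\<^sub>c\<close> is used, and only through the projections
  of the later observations on the direction of \<open>\<delta>\<close>, which are independent with law \<open>N(d, 1)\<close>. By the
  tangent line \<open>sqrt (c * j) \<le> c / (2 * d) + j * d / 2\<close> an alarm is raised at the latest when the random
  walk with steps of law \<open>N(d / 2, 1)\<close> reaches the level \<open>h = c / (2 * d)\<close>, whatever the past is.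
  The mean overshoot of a normal step over a level \<open>a \<ge> 0\<close>, given that the step exceeds \<open>a\<close>, is
  largest for \<open>a = 0\<close>, hence at most \<open>K = d / 2 + sqrt (2 / pi)\<close>. Wald's identity then bounds the
  mean passage time by \<open>(h + K) / (d / 2)\<close>, which is the claim.
\<close>

section \<open>Mean overshoot of a normal step over a level\<close>

text \<open>\<open>sqrt (2 / pi)\<close> is the mean absolute value of a standard normal variable.
  Hence \<open>(\<bar>x\<bar> - sqrt (2 / pi)) * std_normal_density x\<close> is an even function
  with integral \<open>0\<close>, and each half-line carries half of that integral.\<close>

lemma std_normal_positive_part:
  "(\<integral>x. indicator {0..} x * ((x - sqrt (2 / pi)) * std_normal_density x) \<partial>lborel) = 0"
proof -
  define s where "s = sqrt (2 / pi)"
  have b1: "has_bochner_integral lborel (\<lambda>x. std_normal_density x * \<bar>x\<bar>) s"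
    using std_normal_moment_abs_odd[of 0] by (simp add: s_def)
  have b0: "has_bochner_integral lborel (\<lambda>x. std_normal_density x * s) s"
    using has_bochner_integral_mult_left[of s, OF std_normal_moment_even[of 0]] by simp
  define g where "g x = (\<bar>x\<bar> - s) * std_normal_density x" for x
  have bg: "has_bochner_integral lborel g 0"
    using has_bochner_integral_diff[OF b1 b0] by (simp add: g_def[abs_def] algebra_simps)
  then have g: "integrable lborel g" and g0: "(\<integral>x. g x \<partial>lborel) = 0"
    by (auto simp: has_bochner_integral_iff)
  have [measurable]: "g \<in> borel_measurable borel" unfolding g_def by measurable
  have i1: "integrable lborel (\<lambda>x. indicator {0..} x * g x)"
    using integrable_mult_indicator[of "{0..}" lborel g] g by simp
  have i2: "integrable lborel (\<lambda>x. indicator {..0} x * g x)"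
    using integrable_mult_indicator[of "{..0}" lborel g] g by simp
  have "(\<integral>x. indicator {0..} x * g x \<partial>lborel) = (\<integral>x. indicator {0..} (-x) * g (-x) \<partial>lborel)"
    using lborel_integral_real_affine[of "-1" "\<lambda>x. indicator {0..} x * g x" 0] by simp
  also have "\<dots> = (\<integral>x. indicator {..0} x * g x \<partial>lborel)"
    by (rule Bochner_Integration.integral_cong) (auto simp: g_def normal_density_def indicator_def)
  finally have eq: "(\<integral>x. indicator {0..} x * g x \<partial>lborel) = (\<integral>x. indicator {..0} x * g x \<partial>lborel)" .
  have "(\<integral>x. indicator {0..} x * g x \<partial>lborel) + (\<integral>x. indicator {..0} x * g x \<partial>lborel)
     = (\<integral>x. indicator {0..} x * g x + indicator {..0} x * g x \<partial>lborel)"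
    using i1 i2 by simp
  \<comment> \<open>Both half-lines contain \<open>0\<close>, so the integrands agree only off this
    null set.\<close>
  also have "\<dots> = (\<integral>x. g x \<partial>lborel)"
    by (rule integral_cong_AE, measurable)
       (use AE_lborel_singleton[of "0::real"] in eventually_elim, auto simp: indicator_def)
  finally have "(\<integral>x. indicator {0..} x * g x \<partial>lborel) = 0" using eq g0 by simp
  moreover have "indicator {0..} x * g x = indicator {0..} x * ((x - s) * std_normal_density x)" for x
    by (simp add: g_def indicator_def)
  ultimately show ?thesis by (simp add: s_def)
qed

lemma integrable_normal_overshoot:
  assumes "0 < \<sigma>"
  shows "integrable lborel (\<lambda>x. indicator {a..} x * ((x - b) * normal_density \<mu> \<sigma> x))"
proof -
  have "integrable lborel (\<lambda>x. normal_density \<mu> \<sigma> x * x - b * normal_density \<mu> \<sigma> x)"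
    using assms integrable_normal_moment_nz_1[OF assms, of \<mu>] by auto
  then have "integrable lborel (\<lambda>x. (x - b) * normal_density \<mu> \<sigma> x)"
    by (simp add: algebra_simps)
  from integrable_mult_indicator[OF _ this, of "{a..}"] show ?thesis by simp
qed

text \<open>Centring at \<mu> moves the lower end of the integral to \<open>- \<mu>\<close>. Between
  \<open>- \<mu>\<close> and \<open>0\<close> the integrand is negative, so cutting this piece off
  only increases the integral, and the rest is \<open>0\<close> by
  \<open>std_normal_positive_part\<close>.\<close>

lemma normal_overshoot_zero:
  assumes "0 \<le> \<mu>"
  shows "(\<integral>x. indicator {0..} x * ((x - (\<mu> + sqrt (2 / pi))) * normal_density \<mu> 1 x) \<partial>lborel) \<le> 0"
proof -
  define s where "s = sqrt (2 / pi)"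
  have "(\<integral>x. indicator {0..} x * ((x - (\<mu> + s)) * normal_density \<mu> 1 x) \<partial>lborel)
      = (\<integral>x. indicator {-\<mu>..} x * ((x - s) * std_normal_density x) \<partial>lborel)"
    by (subst lborel_integral_real_affine[of 1 _ \<mu>], simp)
       (auto intro!: Bochner_Integration.integral_cong simp: normal_density_def indicator_def)
  also have "\<dots> \<le> (\<integral>x. indicator {0..} x * ((x - s) * std_normal_density x) \<partial>lborel)"
    using assms
    by (intro integral_mono integrable_normal_overshoot)
       (auto simp: indicator_def s_def mult_le_0_iff intro: order_trans[of _ 0])
  also have "\<dots> = 0" unfolding s_def by (rule std_normal_positive_part)
  finally show ?thesis by (simp add: s_def)
qed

text \<open>
  Tilting the density by \<open>exp (- a u)\<close> shifts the threshold from \<open>0\<close> to \<open>a\<close>, and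
  \<open>(u - K) * exp (- a u) \<le> (u - K) * exp (- a K)\<close>, so the case \<open>a = 0\<close> suffices.
\<close>

lemma normal_overshoot:
  assumes "0 \<le> \<mu>" "0 \<le> a"
  shows "(\<integral>x. indicator {a..} x * ((x - (a + (\<mu> + sqrt (2 / pi)))) * normal_density \<mu> 1 x) \<partial>lborel) \<le> 0"
proof -
  define K where "K = \<mu> + sqrt (2 / pi)"
  \<comment> \<open>\<open>C\<close> is the factor free of \<open>u\<close> that appears when the
    square in the exponent is expanded.\<close>
  define C where "C = exp (a * \<mu> - a\<^sup>2 / 2)"
  have tilt: "normal_density \<mu> 1 (a + u) = C * exp (- a * u) * normal_density \<mu> 1 u" for u
  proof -
    have "- (a + u - \<mu>)\<^sup>2 / 2 = (a * \<mu> - a\<^sup>2 / 2) + (- a * u) + (- (u - \<mu>)\<^sup>2 / 2)"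
      by (simp add: power2_eq_square field_simps)
    then have "exp (- (a + u - \<mu>)\<^sup>2 / 2) = C * exp (- a * u) * exp (- (u - \<mu>)\<^sup>2 / 2)"
      unfolding C_def exp_add[symmetric] by (rule arg_cong)
    then show ?thesis by (simp add: normal_density_def)
  qed
  \<comment> \<open>As \<open>0 \<le> a\<close>, the exponential is nonincreasing, so replacing
    \<open>u\<close> by \<open>K\<close> in it lowers a nonpositive weight's factor and raises a
    nonnegative weight's factor.\<close>
  have cheb: "(u - K) * exp (- a * u) \<le> (u - K) * exp (- a * K)" for u
  proof (cases "u \<le> K")
    case True
    with assms show ?thesis by (intro mult_left_mono_neg) (auto simp: mult_left_mono)
  next
    case False
    with assms show ?thesis by (intro mult_left_mono) (auto simp: mult_left_mono)
  qed
  have i: "integrable lborel (\<lambda>x. indicator {0..} x * ((a + x - (a + K)) * normal_density \<mu> 1 (a + x)))"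
    using lborel_integrable_real_affine[OF integrable_normal_overshoot[of 1 a "a + K" \<mu>], of 1 a]
    by (simp add: indicator_def)
  have "(\<integral>x. indicator {a..} x * ((x - (a + K)) * normal_density \<mu> 1 x) \<partial>lborel)
      = (\<integral>x. indicator {0..} x * ((a + x - (a + K)) * normal_density \<mu> 1 (a + x)) \<partial>lborel)"
    by (subst lborel_integral_real_affine[of 1 _ a], simp)
       (auto intro!: Bochner_Integration.integral_cong simp: indicator_def)
  also have "\<dots> \<le> (\<integral>x. C * exp (- a * K) * (indicator {0..} x * ((x - K) * normal_density \<mu> 1 x)) \<partial>lborel)"
  proof (rule integral_mono[OF i])
    show "integrable lborel (\<lambda>x. C * exp (- a * K) * (indicator {0..} x * ((x - K) * normal_density \<mu> 1 x)))"
      by (intro integrable_mult_right integrable_normal_overshoot) simp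
    fix x :: real
    have "C * normal_density \<mu> 1 x * ((x - K) * exp (- a * x)) \<le> C * normal_density \<mu> 1 x * ((x - K) * exp (- a * K))"
      by (rule mult_left_mono[OF cheb]) (simp add: C_def)
    then show "indicator {0..} x * ((a + x - (a + K)) * normal_density \<mu> 1 (a + x))
        \<le> C * exp (- a * K) * (indicator {0..} x * ((x - K) * normal_density \<mu> 1 x))"
      by (auto simp: indicator_def tilt algebra_simps)
  qed
  also have "\<dots> = C * exp (- a * K) * (\<integral>x. indicator {0..} x * ((x - K) * normal_density \<mu> 1 x) \<partial>lborel)"
    by simp
  also have "\<dots> \<le> 0"
    using normal_overshoot_zero[OF assms(1)] by (intro mult_nonneg_nonpos) (auto simp: C_def K_def)
  finally show ?thesis by (simp add: K_def)
qed

text \<open>The mean of \<open>a + K - x\<close> over all steps is \<open>a + K - \<mu>\<close>.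
  Keeping only the steps \<open>x < a\<close> adds the integral of \<open>x - (a + K)\<close> over
  \<open>{a..}\<close>, which is nonpositive by \<open>normal_overshoot\<close>. In the walk,
  \<open>a\<close> is the distance left to the level. The drift stands on the left to avoid
  subtraction in \<open>ennreal\<close>.\<close>

lemma normal_step:
  fixes \<mu> a :: real
  defines "K \<equiv> \<mu> + sqrt (2 / pi)"
  assumes "0 \<le> \<mu>" "0 \<le> a"
  shows "(\<integral>\<^sup>+x. ennreal (indicator {..<a} x * (a - x + K)) * ennreal (normal_density \<mu> 1 x) \<partial>lborel) + ennreal \<mu>
           \<le> ennreal (a + K)"
proof -
  have K: "0 \<le> K" using assms by (simp add: K_def)
  have n: "has_bochner_integral lborel (normal_density \<mu> 1) 1"
    by (simp add: has_bochner_integral_iff)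
  have i1: "has_bochner_integral lborel (\<lambda>x. (a + K) * normal_density \<mu> 1 x - normal_density \<mu> 1 x * x) (a + K - \<mu>)"
    using has_bochner_integral_diff[OF has_bochner_integral_mult_right[of "a + K", OF n] normal_moment_nz_1[of 1 \<mu>]]
    by simp
  have i2: "integrable lborel (\<lambda>x. indicator {a..} x * ((x - (a + K)) * normal_density \<mu> 1 x))"
    by (rule integrable_normal_overshoot) simp
  have eq: "indicator {..<a} x * (a - x + K) * normal_density \<mu> 1 x =
      ((a + K) * normal_density \<mu> 1 x - normal_density \<mu> 1 x * x)
        + indicator {a..} x * ((x - (a + K)) * normal_density \<mu> 1 x)" for x
    by (auto simp: indicator_def algebra_simps)
  have int: "integrable lborel (\<lambda>x. indicator {..<a} x * (a - x + K) * normal_density \<mu> 1 x)"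
    unfolding eq using i1 i2 by (intro Bochner_Integration.integrable_add) (auto simp: has_bochner_integral_iff)
  have "(\<integral>\<^sup>+x. ennreal (indicator {..<a} x * (a - x + K)) * ennreal (normal_density \<mu> 1 x) \<partial>lborel)
      = (\<integral>\<^sup>+x. ennreal (indicator {..<a} x * (a - x + K) * normal_density \<mu> 1 x) \<partial>lborel)"
    using K by (intro nn_integral_cong ennreal_mult[symmetric]) (auto simp: indicator_def)
  also have "\<dots> = ennreal (\<integral>x. indicator {..<a} x * (a - x + K) * normal_density \<mu> 1 x \<partial>lborel)"
    using K by (intro nn_integral_eq_integral int AE_I2) (auto simp: indicator_def intro!: mult_nonneg_nonneg)
  also have "(\<integral>x. indicator {..<a} x * (a - x + K) * normal_density \<mu> 1 x \<partial>lborel)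
      = (a + K - \<mu>) + (\<integral>x. indicator {a..} x * ((x - (a + K)) * normal_density \<mu> 1 x) \<partial>lborel)"
    unfolding eq using i1 i2 by (subst Bochner_Integration.integral_add) (auto simp: has_bochner_integral_iff)
  finally have "(\<integral>\<^sup>+x. ennreal (indicator {..<a} x * (a - x + K)) * ennreal (normal_density \<mu> 1 x) \<partial>lborel) \<le> ennreal (a + K - \<mu>)"
    using normal_overshoot[of \<mu> a] assms by (simp only:) (auto intro!: ennreal_leI simp del: ennreal_plus)
  then have "(\<integral>\<^sup>+x. ennreal (indicator {..<a} x * (a - x + K)) * ennreal (normal_density \<mu> 1 x) \<partial>lborel) + ennreal \<mu>
      \<le> ennreal (a + K - \<mu>) + ennreal \<mu>"
    by (rule add_right_mono)
  also have "\<dots> = ennreal (a + K)"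
    using assms by (subst ennreal_plus[symmetric]) (auto simp: K_def)
  finally show ?thesis .
qed

section \<open>Coordinates and projections of a standard normal vector\<close>

lemma std_mvn_density_eq_prod:
  "std_mvn_density (x :: real ^ 'p) = (\<Prod>b\<in>Basis. std_normal_density (x \<bullet> b))"
proof -
  have "(norm x)\<^sup>2 = (\<Sum>b\<in>Basis. (x \<bullet> b)\<^sup>2)"
    unfolding power2_norm_eq_inner by (subst euclidean_inner) (simp add: power2_eq_square)
  then have "exp (- (norm x)\<^sup>2 / 2) = (\<Prod>b\<in>Basis. exp (- (x \<bullet> b)\<^sup>2 / 2))"
    by (simp add: exp_sum[symmetric] sum_negf sum_divide_distrib)
  then show ?thesis
    by (simp add: std_mvn_density_def std_normal_density_def prod_dividef)
qed

context prob_space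
begin

text \<open>Since the density factors over the coordinates, its integral over a box splits into
  one-dimensional integrals. This product formula yields both the law of each coordinate and their
  independence.\<close>

lemma std_mvn_box:
  fixes Z :: "'a \<Rightarrow> real ^ 'p"
  assumes Z: "distributed M lborel Z (\<lambda>x. ennreal (std_mvn_density x))"
    and A: "\<And>b. b \<in> Basis \<Longrightarrow> A b \<in> sets borel"
  shows "emeasure M {\<omega>\<in>space M. \<forall>b\<in>Basis. Z \<omega> \<bullet> b \<in> A b} =
           (\<Prod>b\<in>Basis. emeasure (density lborel std_normal_density) (A b))"
proof -
  have [measurable]: "Z \<in> borel_measurable M" using distributed_measurable[OF Z] by simp
  have [measurable]: "b \<in> Basis \<Longrightarrow> Measurable.pred borel (\<lambda>x. x \<bullet> b \<in> A b)" for b :: "real ^ 'p"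
    using A[of b] by (intro pred_sets2[where N=borel]) auto
  have "emeasure M {\<omega>\<in>space M. \<forall>b\<in>Basis. Z \<omega> \<bullet> b \<in> A b}
      = (\<integral>\<^sup>+\<omega>. indicator {x. \<forall>b\<in>Basis. x \<bullet> b \<in> A b} (Z \<omega>) \<partial>M)"
  proof -
    have "{\<omega>\<in>space M. \<forall>b\<in>Basis. Z \<omega> \<bullet> b \<in> A b} \<in> sets M" by measurable
    from nn_integral_indicator[OF this, symmetric] show ?thesis
      by (simp add: indicator_def cong: nn_integral_cong)
  qed
  also have "\<dots> = (\<integral>\<^sup>+x. ennreal (std_mvn_density x) * indicator {x. \<forall>b\<in>Basis. x \<bullet> b \<in> A b} x \<partial>lborel)"
    by (rule distributed_nn_integral[OF Z, symmetric]) measurable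
  also have "\<dots> = (\<integral>\<^sup>+x. (\<Prod>b\<in>Basis. ennreal (std_normal_density (x \<bullet> b)) * indicator (A b) (x \<bullet> b)) \<partial>lborel)"
    by (intro nn_integral_cong)
       (auto simp: std_mvn_density_eq_prod prod.distrib prod_ennreal indicator_def prod_zero_iff)
  also have "\<dots> = (\<Prod>b\<in>Basis. \<integral>\<^sup>+x. ennreal (std_normal_density x) * indicator (A b) x \<partial>lborel)"
    using A by (intro nn_integral_lborel_prod) auto
  also have "\<dots> = (\<Prod>b\<in>Basis. emeasure (density lborel std_normal_density) (A b))"
    using A by (intro prod.cong refl) (simp add: emeasure_density)
  finally show ?thesis .
qed

lemma std_mvn_component:
  fixes Z :: "'a \<Rightarrow> real ^ 'p"
  assumes Z: "distributed M lborel Z (\<lambda>x. ennreal (std_mvn_density x))"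
    and b: "b \<in> Basis"
  shows "distributed M lborel (\<lambda>\<omega>. Z \<omega> \<bullet> b) std_normal_density"
proof -
  interpret N: prob_space "density lborel (\<lambda>x. ennreal (std_normal_density x))"
    by (rule prob_space_normal_density) simp
  have [measurable]: "Z \<in> borel_measurable M" using distributed_measurable[OF Z] by simp
  have "distr M lborel (\<lambda>\<omega>. Z \<omega> \<bullet> b) = density lborel std_normal_density"
  proof (rule measure_eqI)
    fix X assume "X \<in> sets (distr M lborel (\<lambda>\<omega>. Z \<omega> \<bullet> b))"
    then have [measurable]: "X \<in> sets borel" by simp
    \<comment> \<open>The event is a box all of whose sides except the one for \<open>b\<close> are
      \<open>UNIV\<close>; those sides contribute the factor \<open>1\<close>.\<close>
    have "emeasure (distr M lborel (\<lambda>\<omega>. Z \<omega> \<bullet> b)) X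
        = emeasure M {\<omega>\<in>space M. \<forall>b'\<in>Basis. Z \<omega> \<bullet> b' \<in> (if b' = b then X else UNIV)}"
      using b by (subst emeasure_distr) (auto intro!: arg_cong[where f="emeasure M"] split: if_splits)
    also have "\<dots> = (\<Prod>b'\<in>Basis. emeasure (density lborel std_normal_density) (if b' = b then X else UNIV))"
      by (rule std_mvn_box[OF Z]) auto
    also have "\<dots> = (\<Prod>b'\<in>Basis. if b' = b then emeasure (density lborel std_normal_density) X else 1)"
      using N.emeasure_space_1 by (intro prod.cong refl) auto
    also have "\<dots> = emeasure (density lborel std_normal_density) X"
      using b by simp
    finally show "emeasure (distr M lborel (\<lambda>\<omega>. Z \<omega> \<bullet> b)) X = emeasure (density lborel std_normal_density) X" .
  qed simp
  then show ?thesis by (simp add: distributed_def)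
qed

text \<open>By \<open>std_mvn_box\<close> the joint law of the coordinates agrees on boxes with the
  product of the marginals, and boxes determine a measure on a finite product.\<close>

lemma std_mvn_components_indep:
  fixes Z :: "'a \<Rightarrow> real ^ 'p"
  assumes Z: "distributed M lborel Z (\<lambda>x. ennreal (std_mvn_density x))"
  shows "indep_vars (\<lambda>_. borel) (\<lambda>b \<omega>. Z \<omega> \<bullet> b) Basis"
proof -
  have [measurable]: "Z \<in> borel_measurable M" using distributed_measurable[OF Z] by simp
  have D: "distr M borel (\<lambda>\<omega>. Z \<omega> \<bullet> b) = density lborel std_normal_density" if "b \<in> Basis" for b
    using distributed_distr_eq_density[OF std_mvn_component[OF Z that]]
    by (metis distr_cong sets_lborel)
  have "distr M (\<Pi>\<^sub>M b\<in>Basis. borel) (\<lambda>\<omega>. \<lambda>b\<in>Basis. Z \<omega> \<bullet> b) = (\<Pi>\<^sub>M b\<in>Basis. distr M borel (\<lambda>\<omega>. Z \<omega> \<bullet> b))"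
  proof (rule product_sigma_finite.PiM_eqI)
    show "product_sigma_finite (\<lambda>b. distr M borel (\<lambda>\<omega>. Z \<omega> \<bullet> b))"
      unfolding product_sigma_finite_def
      by (intro allI prob_space_imp_sigma_finite prob_space_distr) simp
    show "finite (Basis :: (real ^ 'p) set)" by simp
    show "sets (distr M (\<Pi>\<^sub>M b\<in>Basis. borel) (\<lambda>\<omega>. \<lambda>b\<in>Basis. Z \<omega> \<bullet> b)) = sets (\<Pi>\<^sub>M b\<in>Basis. distr M borel (\<lambda>\<omega>. Z \<omega> \<bullet> b))"
      unfolding sets_distr by (intro sets_PiM_cong) auto
    fix A :: "real ^ 'p \<Rightarrow> real set"
    assume "\<And>b. b \<in> Basis \<Longrightarrow> A b \<in> sets (distr M borel (\<lambda>\<omega>. Z \<omega> \<bullet> b))"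
    then have A: "\<And>b. b \<in> Basis \<Longrightarrow> A b \<in> sets borel" by simp
    have "emeasure (distr M (\<Pi>\<^sub>M b\<in>Basis. borel) (\<lambda>\<omega>. \<lambda>b\<in>Basis. Z \<omega> \<bullet> b)) (Pi\<^sub>E Basis A)
        = emeasure M {\<omega>\<in>space M. \<forall>b\<in>Basis. Z \<omega> \<bullet> b \<in> A b}"
      using A by (subst emeasure_distr) (auto intro!: arg_cong[where f="emeasure M"] sets_PiM_I_finite)
    also have "\<dots> = (\<Prod>b\<in>Basis. emeasure (distr M borel (\<lambda>\<omega>. Z \<omega> \<bullet> b)) (A b))"
      by (subst std_mvn_box[OF Z A]) (auto intro!: prod.cong simp: D)
    finally show "emeasure (distr M (\<Pi>\<^sub>M b\<in>Basis. borel) (\<lambda>\<omega>. \<lambda>b\<in>Basis. Z \<omega> \<bullet> b)) (Pi\<^sub>E Basis A)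
        = (\<Prod>b\<in>Basis. emeasure (distr M borel (\<lambda>\<omega>. Z \<omega> \<bullet> b)) (A b))" .
  qed
  then show ?thesis
    by (subst indep_vars_iff_distr_eq_PiM') auto
qed

text \<open>The projection is a sum of independent centred normal variables with standard deviations
  \<open>\<bar>u \<bullet> b\<bar>\<close>, whose squares add up to \<open>1\<close>.\<close>

lemma std_mvn_inner:
  fixes Z :: "'a \<Rightarrow> real ^ 'p"
  assumes Z: "distributed M lborel Z (\<lambda>x. ennreal (std_mvn_density x))"
    and u: "norm u = 1"
  shows "distributed M lborel (\<lambda>\<omega>. u \<bullet> Z \<omega>) std_normal_density"
proof -
  \<comment> \<open>Vanishing coefficients are removed because \<open>normal_density_affine\<close>
    needs a nonzero factor and \<open>sum_indep_normal\<close> positive deviations.\<close>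
  define I where "I = {b \<in> Basis. u \<bullet> b \<noteq> 0}"
  have I: "finite I" "I \<subseteq> Basis" by (auto simp: I_def)
  have sum_I: "(\<Sum>b\<in>I. u \<bullet> b * f b) = (\<Sum>b\<in>Basis. u \<bullet> b * f b)" for f
    by (rule sum.mono_neutral_left) (auto simp: I_def)
  have "(\<Sum>b\<in>I. u \<bullet> b * (u \<bullet> b)) = 1"
    unfolding sum_I using u by (simp add: euclidean_inner[symmetric] norm_eq_1)
  then have sq: "(\<Sum>b\<in>I. \<bar>u \<bullet> b\<bar>\<^sup>2) = 1" by (simp add: power2_eq_square)
  have "indep_vars (\<lambda>_. borel) (\<lambda>b \<omega>. u \<bullet> b * (Z \<omega> \<bullet> b)) Basis"
    by (rule indep_vars_compose2[OF std_mvn_components_indep[OF Z]]) simp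
  then have ind: "indep_vars (\<lambda>_. borel) (\<lambda>b \<omega>. u \<bullet> b * (Z \<omega> \<bullet> b)) I"
    by (rule indep_vars_subset) fact
  have d: "distributed M lborel (\<lambda>\<omega>. u \<bullet> b * (Z \<omega> \<bullet> b)) (normal_density 0 \<bar>u \<bullet> b\<bar>)" if "b \<in> I" for b
    using normal_density_affine[OF std_mvn_component[OF Z, of b], of "u \<bullet> b" 0] that by (simp add: I_def)
  have "I \<noteq> {}" using sq by auto
  from sum_indep_normal[OF I(1) this ind _ d]
  have "distributed M lborel (\<lambda>\<omega>. \<Sum>b\<in>I. u \<bullet> b * (Z \<omega> \<bullet> b)) (normal_density 0 (sqrt (\<Sum>b\<in>I. \<bar>u \<bullet> b\<bar>\<^sup>2)))"
    by (simp add: I_def)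
  then have "distributed M lborel (\<lambda>\<omega>. \<Sum>b\<in>I. u \<bullet> b * (Z \<omega> \<bullet> b)) std_normal_density"
    unfolding sq by simp
  then show ?thesis
    unfolding sum_I by (simp add: euclidean_inner[symmetric])
qed

section \<open>Mean first passage time of a normal random walk\<close>

text \<open>
  Wald's identity and the overshoot bound in one: \<open>h - V m + K\<close>, restricted to the event \<open>A m\<close> that the
  walk \<open>V\<close> stayed below \<open>h\<close>, loses at least \<open>\<mu> * P (A m)\<close> in mean at each step.
\<close>

lemma first_passage_normal_walk:
  fixes X :: "nat \<Rightarrow> 'a \<Rightarrow> real" and \<mu> h :: real and k n :: nat
  defines "K \<equiv> \<mu> + sqrt (2 / pi)"
    and "A \<equiv> \<lambda>m. {\<omega>\<in>space M. \<forall>j\<in>{1..m}. (\<Sum>i = k + 1..k + j. X i \<omega>) < h}"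
  assumes ind: "indep_vars (\<lambda>_. borel) X {k<..}"
    and X: "\<And>i. k < i \<Longrightarrow> distributed M lborel (X i) (normal_density \<mu> 1)"
    and "0 \<le> \<mu>" "0 \<le> h"
  shows "(\<Sum>m<n. ennreal \<mu> * emeasure M (A m)) \<le> ennreal (h + K)"
proof -
  define V where "V m \<omega> = (\<Sum>i = k + 1..k + m. X i \<omega>)" for m \<omega>
  \<comment> \<open>On \<open>A m\<close> the value \<open>h - V m \<omega> + K\<close> is
    nonnegative, so \<open>ennreal\<close> truncates nothing there.\<close>
  define \<Psi> where "\<Psi> m = (\<integral>\<^sup>+\<omega>. indicator (A m) \<omega> * ennreal (h - V m \<omega> + K) \<partial>M)" for m
  have K: "0 \<le> K" using assms by (simp add: K_def)
  have [measurable]: "k < i \<Longrightarrow> X i \<in> borel_measurable M" for i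
    using ind by (auto simp: indep_vars_def)
  have [measurable]: "A m \<in> sets M" for m unfolding A_def by measurable
  have step: "\<Psi> (Suc m) + ennreal \<mu> * emeasure M (A m) \<le> \<Psi> m" for m
  proof -
    define J where "J = {k + 1..k + m}"
    define P where "P = (PiM J (\<lambda>_. borel) :: (nat \<Rightarrow> real) measure)"
    define F where "F = (\<lambda>\<omega>. restrict (\<lambda>i. X i \<omega>) J)"
    define W where "W j f = (\<Sum>i = k + 1..k + j. f i)" for j and f :: "nat \<Rightarrow> real"
    define B where "B f \<longleftrightarrow> (\<forall>j\<in>{1..m}. W j f < h)" for f
    \<comment> \<open>The next step is encoded as a one-point product, so that
      \<open>indep_var_restrict\<close> separates it from the first \<open>m\<close> steps.\<close>
    define Q where "Q = (PiM {Suc (k + m)} (\<lambda>_. borel) :: (nat \<Rightarrow> real) measure)"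
    define H where "H = (\<lambda>\<omega>. restrict (\<lambda>i. X i \<omega>) {Suc (k + m)})"
    \<comment> \<open>\<open>S f x\<close> is the distance left plus \<open>K\<close> after a step
      \<open>x\<close> from the past \<open>f\<close>, set to \<open>0\<close> once the walk reaches
      \<open>h\<close>.\<close>
    define S where "S f x = indicator {..<h - W m f} x * (h - W m f - x + K)" for f x
    define G where "G = (\<lambda>(f, g). indicator {f. B f} f * ennreal (S f (g (Suc (k + m)))))"
    have [measurable]: "W j \<in> borel_measurable P" if "j \<le> m" for j
      unfolding W_def P_def J_def
      by (intro borel_measurable_sum measurable_component_singleton) (use that in auto)
    from this[of m] have [measurable]: "W m \<in> borel_measurable P" by simp
    have [measurable]: "Measurable.pred P B" unfolding B_def by measurable
    have [measurable]: "(\<lambda>g. g (Suc (k + m))) \<in> borel_measurable Q"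
      unfolding Q_def by (rule measurable_component_singleton) simp
    have G [measurable]: "G \<in> borel_measurable (P \<Otimes>\<^sub>M Q)"
      unfolding G_def S_def case_prod_beta' by (simp add: indicator_def) measurable
    have "indep_var P F Q H"
      unfolding P_def F_def Q_def H_def J_def by (rule indep_var_restrict[OF ind]) auto
    then have [measurable]: "F \<in> M \<rightarrow>\<^sub>M P" "H \<in> M \<rightarrow>\<^sub>M Q"
      and D: "distr M P F \<Otimes>\<^sub>M distr M Q H = distr M (P \<Otimes>\<^sub>M Q) (\<lambda>\<omega>. (F \<omega>, H \<omega>))"
      by (auto simp: indep_var_distribution_eq)
    interpret H: prob_space "distr M Q H" by (rule prob_space_distr) simp
    have H: "H \<omega> (Suc (k + m)) = X (Suc (k + m)) \<omega>" for \<omega> by (simp add: H_def)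
    have WF: "W j (F \<omega>) = V j \<omega>" if "j \<le> m" for j \<omega>
      unfolding W_def F_def V_def J_def by (rule sum.cong) (use that in auto)
    then have BF: "B (F \<omega>) \<longleftrightarrow> \<omega> \<in> A m" if "\<omega> \<in> space M" for \<omega>
      using that by (auto simp: B_def A_def V_def)
    have V_Suc: "V (Suc m) \<omega> = V m \<omega> + X (Suc (k + m)) \<omega>" for \<omega>
      by (simp add: V_def)
    have A_Suc: "\<omega> \<in> A (Suc m) \<longleftrightarrow> \<omega> \<in> A m \<and> V (Suc m) \<omega> < h" for \<omega>
    proof -
      have "{1..Suc m} = insert (Suc m) {1..m}" by auto
      then show ?thesis unfolding A_def V_def by auto
    qed
    have "\<Psi> (Suc m) = (\<integral>\<^sup>+\<omega>. G (F \<omega>, H \<omega>) \<partial>M)"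
      unfolding \<Psi>_def
      by (intro nn_integral_cong) (auto simp: G_def S_def H WF BF A_Suc V_Suc indicator_def algebra_simps)
    also have "\<dots> = (\<integral>\<^sup>+p. G p \<partial>distr M (P \<Otimes>\<^sub>M Q) (\<lambda>\<omega>. (F \<omega>, H \<omega>)))"
      by (rule nn_integral_distr[symmetric]) measurable
    \<comment> \<open>Independence makes the joint law a product, so the past can be frozen while
      the next step is averaged by \<open>normal_step\<close>.\<close>
    also have "\<dots> = (\<integral>\<^sup>+f. \<integral>\<^sup>+g. G (f, g) \<partial>distr M Q H \<partial>distr M P F)"
    proof -
      have "G \<in> borel_measurable (distr M P F \<Otimes>\<^sub>M distr M Q H)" using G by (simp add: D)
      from H.nn_integral_fst[OF this] show ?thesis by (simp add: D)
    qed
    also have "\<dots> = (\<integral>\<^sup>+\<omega>. \<integral>\<^sup>+g. G (F \<omega>, g) \<partial>distr M Q H \<partial>M)"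
      by (rule nn_integral_distr) measurable
    finally have "\<Psi> (Suc m) + ennreal \<mu> * emeasure M (A m)
        = (\<integral>\<^sup>+\<omega>. \<integral>\<^sup>+g. G (F \<omega>, g) \<partial>distr M Q H \<partial>M) + (\<integral>\<^sup>+\<omega>. ennreal \<mu> * indicator (A m) \<omega> \<partial>M)"
      by (simp add: nn_integral_cmult_indicator)
    also have "\<dots> = (\<integral>\<^sup>+\<omega>. (\<integral>\<^sup>+g. G (F \<omega>, g) \<partial>distr M Q H) + ennreal \<mu> * indicator (A m) \<omega> \<partial>M)"
      by (rule nn_integral_add[symmetric]) measurable
    also have "\<dots> \<le> \<Psi> m"
      unfolding \<Psi>_def
    proof (rule nn_integral_mono)
      fix \<omega> assume \<omega>: "\<omega> \<in> space M"
      show "(\<integral>\<^sup>+g. G (F \<omega>, g) \<partial>distr M Q H) + ennreal \<mu> * indicator (A m) \<omega> \<le> indicator (A m) \<omega> * ennreal (h - V m \<omega> + K)"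
      proof (cases "\<omega> \<in> A m")
        case True
        define a where "a = h - V m \<omega>"
        \<comment> \<open>For \<open>m = 0\<close> no partial sum is constrained, and the bound
          comes from \<open>0 \<le> h\<close>.\<close>
        have "0 \<le> a"
        proof (cases "m = 0")
          case False
          then have "m \<in> {1..m}" by simp
          with True have "V m \<omega> < h" unfolding A_def V_def by blast
          then show ?thesis by (simp add: a_def)
        qed (use \<open>0 \<le> h\<close> in \<open>simp add: V_def a_def\<close>)
        have "(\<integral>\<^sup>+g. G (F \<omega>, g) \<partial>distr M Q H) = (\<integral>\<^sup>+g. ennreal (S (F \<omega>) (g (Suc (k + m)))) \<partial>distr M Q H)"
          using True \<omega> by (simp add: G_def BF)
        also have "\<dots> = (\<integral>\<^sup>+\<omega>'. ennreal (S (F \<omega>) (X (Suc (k + m)) \<omega>')) \<partial>M)"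
          unfolding S_def by (subst nn_integral_distr) (simp_all add: H)
        also have "\<dots> = (\<integral>\<^sup>+x. ennreal (normal_density \<mu> 1 x) * ennreal (S (F \<omega>) x) \<partial>lborel)"
          unfolding S_def by (intro distributed_nn_integral[OF X, symmetric]) simp_all
        also have "\<dots> = (\<integral>\<^sup>+x. ennreal (indicator {..<a} x * (a - x + K)) * ennreal (normal_density \<mu> 1 x) \<partial>lborel)"
          by (simp add: S_def WF a_def mult.commute)
        finally show ?thesis
          using normal_step[OF \<open>0 \<le> \<mu>\<close> \<open>0 \<le> a\<close>] True by (simp add: K_def a_def)
      qed (use \<omega> in \<open>simp add: G_def BF\<close>)
    qed
    finally show ?thesis .
  qed
  \<comment> \<open>The one-step losses telescope; the nonnegative remainder \<open>\<Psi> n\<close>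
    is dropped at the end.\<close>
  have "\<Psi> n + (\<Sum>m<n. ennreal \<mu> * emeasure M (A m)) \<le> \<Psi> 0"
  proof (induction n)
    case (Suc n)
    have "\<Psi> (Suc n) + (\<Sum>m<Suc n. ennreal \<mu> * emeasure M (A m))
        = (\<Psi> (Suc n) + ennreal \<mu> * emeasure M (A n)) + (\<Sum>m<n. ennreal \<mu> * emeasure M (A m))"
      by (simp add: ac_simps)
    also have "\<dots> \<le> \<Psi> n + (\<Sum>m<n. ennreal \<mu> * emeasure M (A m))"
      by (rule add_right_mono[OF step])
    finally show ?case using Suc.IH by (rule order_trans)
  qed simp
  moreover have "\<Psi> 0 = ennreal (h + K)"
  proof -
    have "\<Psi> 0 = (\<integral>\<^sup>+\<omega>. ennreal (h + K) \<partial>M)"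
      unfolding \<Psi>_def by (rule nn_integral_cong) (simp add: A_def V_def)
    then show ?thesis by (simp add: emeasure_space_1)
  qed
  ultimately show ?thesis
    by (metis add.commute add_increasing2 le_iff_add order_trans zero_le)
qed

end

section \<open>From the absence of an alarm to a walk below a level\<close>

text \<open>Without an alarm the norm of the sum is below \<open>sqrt (c * j)\<close>. The line
  \<open>c / (2 * d) + j * d / 2\<close> touches this curve at \<open>j = c / d\<^sup>2\<close>,
  where the curve also meets \<open>d * j\<close>, the mean of the projected sum in the application.
  Its slope is absorbed into the steps and leaves a constant level.\<close>

lemma dense_stat_less_imp_inner_less:
  fixes y :: "nat \<Rightarrow> 'v::real_inner"
  assumes "1 \<le> j" "dense_stat y k (k + j) < c" "norm u = 1" "0 < d" "0 < c"
  shows "(\<Sum>i = k + 1..k + j. u \<bullet> y i - d / 2) < c / (2 * d)"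
proof -
  define S where "S = (\<Sum>i = k + 1..k + j. y i)"
  have "(norm S)\<^sup>2 / real j < c"
    using assms by (simp add: dense_stat_def S_def power_mult_distrib power_divide)
  then have "(norm S)\<^sup>2 < c * real j" using assms by (simp add: field_simps)
  also have "c * real j \<le> (c / (2 * d) + real j * d / 2)\<^sup>2"
  proof -
    have "(c / (2 * d) + real j * d / 2)\<^sup>2 - c * real j = (c / (2 * d) - real j * d / 2)\<^sup>2"
      using assms by (simp add: power2_eq_square field_simps)
    then show ?thesis using zero_le_power2[of "c / (2 * d) - real j * d / 2"] by linarith
  qed
  finally have "norm S < c / (2 * d) + real j * d / 2"
    by (rule power2_less_imp_less) (use assms in auto)
  moreover have "u \<bullet> S \<le> norm S" using norm_cauchy_schwarz[of u S] assms by simp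
  moreover have "(\<Sum>i = k + 1..k + j. u \<bullet> y i - d / 2) = u \<bullet> S - real j * d / 2"
    by (simp add: S_def inner_sum_right sum_subtractf)
  ultimately show ?thesis by simp
qed

lemma less_detection_time_imp_dense_stat_less:
  assumes "enat n < detection_time c y" "1 \<le> \<tau>" "\<tau> < n"
  shows "dense_stat y \<tau> n < c"
proof -
  \<comment> \<open>\<open>enat_le_detection_time_iff\<close> covers only times strictly below its
    bound, hence the successor.\<close>
  have "enat (Suc n) \<le> detection_time c y" using assms(1) by (simp add: Suc_ile_eq)
  then have "(MAX \<tau>\<in>{1..<n}. dense_stat y \<tau> n) < c"
    using assms by (auto simp: enat_le_detection_time_iff)
  moreover have "dense_stat y \<tau> n \<le> (MAX \<tau>\<in>{1..<n}. dense_stat y \<tau> n)"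
    using assms by (intro Max_ge) auto
  ultimately show ?thesis by simp
qed

section \<open>Bound on the average detection delay\<close>

theorem lemma6:
  fixes M :: "'a measure"
    and \<epsilon> y :: "nat \<Rightarrow> 'a \<Rightarrow> real ^ 'p"
    and \<delta> :: "real ^ 'p"
    and \<tau>\<^sub>c :: nat
    and c :: real
  assumes "prob_space M"
    and "prob_space.indep_vars M (\<lambda>_. borel) \<epsilon> {1..}"
    and "\<And>t. 1 \<le> t \<Longrightarrow> distributed M lborel (\<epsilon> t) (\<lambda>x. ennreal (std_mvn_density x))"
    and "\<And>t \<omega>. 1 \<le> t \<Longrightarrow> t \<le> \<tau>\<^sub>c \<Longrightarrow> y t \<omega> = \<epsilon> t \<omega>"
    and "\<And>t \<omega>. \<tau>\<^sub>c < t \<Longrightarrow> y t \<omega> = \<delta> + \<epsilon> t \<omega>"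
    and "1 \<le> \<tau>\<^sub>c"
    and "0 < norm \<delta>"
    and "0 < c"
  shows "ADD M y \<tau>\<^sub>c c \<le> ennreal ((c + norm \<delta> * sqrt (8 / pi)) / (norm \<delta>)\<^sup>2 + 1)"
proof -
  interpret prob_space M by fact
  note ind = assms(2) and Z = assms(3) and post = assms(5)
  define d where "d = norm \<delta>"
  define u where "u = \<delta> /\<^sub>R d"
  define h where "h = c / (2 * d)"
  define K where "K = d / 2 + sqrt (2 / pi)"
  have d: "0 < d" using assms by (simp add: d_def)
  have u: "norm u = 1" using d by (simp add: u_def d_def)
  have u\<delta>: "u \<bullet> \<delta> = d"
    using d by (simp add: u_def d_def dot_square_norm power2_eq_square)
  \<comment> \<open>Subtracting the slope \<open>d / 2\<close> of the tangent line leaves half of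
    the drift \<open>d\<close> after the change.\<close>
  define X where "X i \<omega> = u \<bullet> y i \<omega> - d / 2" for i \<omega>
  define A where "A m = {\<omega>\<in>space M. \<forall>j\<in>{1..m}. (\<Sum>i = \<tau>\<^sub>c + 1..\<tau>\<^sub>c + j. X i \<omega>) < h}" for m
  have X_eq: "X i = (\<lambda>\<omega>. d / 2 + u \<bullet> \<epsilon> i \<omega>)" if "\<tau>\<^sub>c < i" for i
    using that by (simp add: X_def post inner_add_right u\<delta> fun_eq_iff)
  have \<epsilon> [measurable]: "1 \<le> t \<Longrightarrow> \<epsilon> t \<in> borel_measurable M" for t
    using ind by (auto simp: indep_vars_def)
  have indX: "indep_vars (\<lambda>_. borel) X {\<tau>\<^sub>c<..}"
  proof -
    have "indep_vars (\<lambda>_. borel) (\<lambda>i \<omega>. d / 2 + u \<bullet> \<epsilon> i \<omega>) {1..}"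
      by (rule indep_vars_compose2[OF ind]) measurable
    then have "indep_vars (\<lambda>_. borel) (\<lambda>i \<omega>. d / 2 + u \<bullet> \<epsilon> i \<omega>) {\<tau>\<^sub>c<..}"
      by (rule indep_vars_subset) auto
    then show ?thesis
      by (subst indep_vars_cong[OF refl X_eq refl]) auto
  qed
  have distX: "distributed M lborel (X i) (normal_density (d / 2) 1)" if "\<tau>\<^sub>c < i" for i
  proof -
    have "distributed M lborel (\<lambda>\<omega>. u \<bullet> \<epsilon> i \<omega>) std_normal_density"
      by (rule std_mvn_inner[OF Z u]) (use that in simp)
    from normal_density_affine[OF this, of 1 "d / 2"] show ?thesis
      by (simp add: X_eq[OF that])
  qed
  have [measurable]: "A m \<in> sets M" for m
  proof -
    have [measurable]: "\<tau>\<^sub>c < i \<Longrightarrow> X i \<in> borel_measurable M" for i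
      using indX by (auto simp: indep_vars_def)
    show ?thesis unfolding A_def by measurable
  qed
  have walk: "ennreal (d / 2) * (\<Sum>m. emeasure M (A m)) \<le> ennreal (h + K)"
  proof -
    have "(\<Sum>m<n. ennreal (d / 2) * emeasure M (A m)) \<le> ennreal (h + K)" for n
      unfolding A_def K_def
      using first_passage_normal_walk[OF indX distX] d assms by (simp add: h_def)
    then show ?thesis
      unfolding ennreal_suminf_cmult[symmetric] by (intro suminf_le_const summableI)
  qed
  \<comment> \<open>The sums from \<open>\<tau>\<^sub>c + 1\<close> on do not involve
    \<open>x\<close>, so one bound serves every past.\<close>
  have "cond_delay M y \<tau>\<^sub>c c x \<le> ennreal ((c + d * sqrt (8 / pi)) / d\<^sup>2 + 1)" for x
  proof -
    define f where "f \<omega> = detection_time c (with_past \<tau>\<^sub>c x (\<lambda>t. y t \<omega>)) - enat \<tau>\<^sub>c" for \<omega>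
    have "(\<lambda>\<omega>. detection_time c (\<lambda>t. with_past \<tau>\<^sub>c x (\<lambda>t. y t \<omega>) t)) \<in> M \<rightarrow>\<^sub>M count_space UNIV"
    proof (rule measurable_detection_time)
      fix t :: nat assume "1 \<le> t"
      then show "(\<lambda>\<omega>. with_past \<tau>\<^sub>c x (\<lambda>t. y t \<omega>) t) \<in> borel_measurable M"
        by (cases "t \<le> \<tau>\<^sub>c") (auto simp: with_past_def post)
    qed
    then have f: "f \<in> M \<rightarrow>\<^sub>M count_space UNIV"
      unfolding f_def by (rule measurable_compose) simp
    \<comment> \<open>A delay above \<open>m\<close> excludes an alarm at each time
      \<open>\<tau>\<^sub>c + j\<close> with \<open>1 \<le> j \<le> m\<close>. The candidate
      \<open>\<tau>\<^sub>c\<close> is among those maximised over because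
      \<open>1 \<le> \<tau>\<^sub>c\<close>.\<close>
    have sub: "{\<omega>\<in>space M. enat m < f \<omega>} \<subseteq> A m" for m
    proof safe
      fix \<omega> assume \<omega>: "\<omega> \<in> space M" and m: "enat m < f \<omega>"
      define z where "z = with_past \<tau>\<^sub>c x (\<lambda>t. y t \<omega>)"
      have T: "enat (\<tau>\<^sub>c + m) < detection_time c z"
        using m unfolding f_def z_def[symmetric] by (cases "detection_time c z") auto
      have "(\<Sum>i = \<tau>\<^sub>c + 1..\<tau>\<^sub>c + j. X i \<omega>) < h" if "j \<in> {1..m}" for j
      proof -
        have "enat (\<tau>\<^sub>c + j) < detection_time c z"
          by (rule le_less_trans[OF _ T]) (use that in simp)
        then have "dense_stat z \<tau>\<^sub>c (\<tau>\<^sub>c + j) < c"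
          by (rule less_detection_time_imp_dense_stat_less) (use that assms in auto)
        then have "(\<Sum>i = \<tau>\<^sub>c + 1..\<tau>\<^sub>c + j. u \<bullet> z i - d / 2) < h"
          unfolding h_def using that u d assms by (intro dense_stat_less_imp_inner_less) auto
        also have "(\<Sum>i = \<tau>\<^sub>c + 1..\<tau>\<^sub>c + j. u \<bullet> z i - d / 2) = (\<Sum>i = \<tau>\<^sub>c + 1..\<tau>\<^sub>c + j. X i \<omega>)"
          by (rule sum.cong) (auto simp: X_def z_def with_past_def)
        finally show ?thesis .
      qed
      with \<omega> show "\<omega> \<in> A m" by (simp add: A_def)
    qed
    \<comment> \<open>Tail-sum formula for the mean of a variable with values in
      \<open>enat\<close>.\<close>
    have "cond_delay M y \<tau>\<^sub>c c x = (\<Sum>m. emeasure M {\<omega>\<in>space M. enat m < f \<omega>})"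
      unfolding cond_delay_def f_def[symmetric] using nn_integral_enat_function[OF f] by simp
    also have "\<dots> \<le> (\<Sum>m. emeasure M (A m))"
      by (intro suminf_le summableI emeasure_mono sub) simp
    also have "\<dots> = ennreal (2 / d) * (ennreal (d / 2) * (\<Sum>m. emeasure M (A m)))"
      using d by (simp add: mult.assoc[symmetric] ennreal_mult[symmetric])
    also have "\<dots> \<le> ennreal (2 / d) * ennreal (h + K)"
      by (rule mult_left_mono[OF walk]) simp
    also have "\<dots> = ennreal (2 / d * (h + K))"
      using d assms by (intro ennreal_mult[symmetric]) (auto simp: h_def K_def)
    \<comment> \<open>The \<open>+ 1\<close> stems from the part \<open>d / 2\<close> of
      \<open>K\<close>, and the term with \<open>sqrt (8 / pi)\<close> from its part
      \<open>sqrt (2 / pi)\<close>.\<close>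
    also have "2 / d * (h + K) = (c + d * sqrt (8 / pi)) / d\<^sup>2 + 1"
    proof -
      have "sqrt (8 / pi) = sqrt (2\<^sup>2 * (2 / pi))" by simp
      also have "\<dots> = 2 * sqrt (2 / pi)" by (subst real_sqrt_mult) simp
      finally have "sqrt (8 / pi) = 2 * sqrt (2 / pi)" .
      then show ?thesis using d by (simp add: h_def K_def field_simps power2_eq_square)
    qed
    finally show ?thesis .
  qed
  then show ?thesis
    unfolding ADD_def d_def by (intro SUP_least)
qed

end
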